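(* Let $1\le n_L\le n$ be integers and let $(\rho,A)\in\mathcal P$ be parameters of the asymmetric hub model with leaders $\{1,\dots,n_L\}$ and nodes $\{1,\dots,n\}$. Assume: (i) $0<\rho_i<1$ for $i=1,\dots,n_L$; (ii) $A_{ij}<1$ for $i=1,\dots,n_L$, $j=1,\dots,n$, $i\ne j$; (iii) for all $i,i'\in\{1,\dots,n_L\}$ with $i\neq i'$ there exists $k\in\{n_L+1,\dots,n\}$ such that $A_{ik}\ne A_{i'k}$. Then $(\rho,A)$ is identifiable: for every $(\tilde\rho,\tilde A)\in\mathcal P$, if $\mathbb P(g\mid\tilde\rho,\tilde A)=\mathbb P(g\mid\rho,A)$ for all $g\in\{0,1\}^n$, then $(\tilde\rho,\tilde A)=(\rho,A)$.
   Context: Asymmetric hub model: the nodes are $1,\dots,n$ and the possible hubs (leaders) are $1,\dots,n_L$. The parameter space $\mathcal P$ is the set of pairs $(\rho,A)$ with $\rho=(\rho_1,\dots,\rho_{n_L})$, $0\le\rho_i\le1$, $\sum_{i=1}^{n_L}\rho_i=1$, and $A=(A_{ij})_{1\le i\le n_L,1\le j\le n}$ with $0\le A_{ij}\le 1$ and $A_{ii}=1$ for $i=1,\dots,n_L$. A single observed group $g=(g_1,\dots,g_n)\in\{0,1\}^n$ has probability $$\mathbb P(g\mid\rho,A)=\sum_{i=1}^{n_L}\rho_i\prod_{j=1}^n A_{ij}^{g_j}(1-A_{ij})^{1-g_j}$$ (with $0^0=1$). Observed data are i.i.d. copies of such a group, so identifiability is a statement about the law of one group. Identifiability is in the strict sense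 (no label swapping allowed); conditions (i)-(iii) are imposed only on $(\rho,A)$, not on $(\tilde\rho,\tilde A)$. *)

theory Defs
  imports Complex_Main "HOL-Library.FuncSet"
begin

text \<open>
  Index sets are \<open>{1..nL}\<close> (hubs) and \<open>{1..n}\<close> (nodes). Vectors, matrices and groups are
  extensional functions (\<open>undefined\<close> outside their index sets), so that HOL equality of
  parameters is exactly componentwise equality on the index sets.
\<close>

definition hub_params :: "nat \<Rightarrow> nat \<Rightarrow> ((nat \<Rightarrow> real) \<times> (nat \<Rightarrow> nat \<Rightarrow> real)) set" where
  "hub_params nL n =
    {(\<rho>, A). \<rho> \<in> {1..nL} \<rightarrow>\<^sub>E {0..1} \<and> (\<Sum>i=1..nL. \<rho> i) = 1 \<and>
             A \<in> {1..nL} \<rightarrow>\<^sub>E ({1..n} \<rightarrow>\<^sub>E {0..1}) \<and> (\<forall>i\<in>{1..nL}. A i i = 1)}"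

definition hub_groups :: "nat \<Rightarrow> (nat \<Rightarrow> nat) set" where
  "hub_groups n = {1..n} \<rightarrow>\<^sub>E {0, 1}"

definition hub_prob ::
  "nat \<Rightarrow> nat \<Rightarrow> (nat \<Rightarrow> real) \<times> (nat \<Rightarrow> nat \<Rightarrow> real) \<Rightarrow> (nat \<Rightarrow> nat) \<Rightarrow> real" where
  "hub_prob nL n = (\<lambda>(\<rho>, A) g.
    \<Sum>i=1..nL. \<rho> i * (\<Prod>j=1..n. A i j ^ g j * (1 - A i j) ^ (1 - g j)))"

text \<open>Strict identifiability: no relabelling of the hubs, and the competing parameter ranges
  over the whole parameter space.\<close>

definition hub_identifiable ::
  "nat \<Rightarrow> nat \<Rightarrow> (nat \<Rightarrow> real) \<times> (nat \<Rightarrow> nat \<Rightarrow> real) \<Rightarrow> bool" where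
  "hub_identifiable nL n \<theta> \<longleftrightarrow>
    (\<forall>\<theta>'\<in>hub_params nL n.
       (\<forall>g\<in>hub_groups n. hub_prob nL n \<theta>' g = hub_prob nL n \<theta> g) \<longrightarrow> \<theta>' = \<theta>)"

end

theory Submission
  imports Defs
begin

text \<open>
  Since \<open>A i i = 1\<close>, a group in which exactly the leaders in \<open>S\<close> are present can only have been
  formed by a hub in \<open>S\<close>. Groups whose only leader is \<open>i\<close> therefore determine \<open>A i k\<close> for every
  follower \<open>k\<close>, together with the product \<open>\<rho> i * (\<Prod>j. 1 - A i j)\<close> over the other leaders \<open>j\<close>.
  Groups whose leaders are exactly \<open>i\<close> and \<open>i'\<close> are a mixture of two components; by (iii) some
  follower separates these, so the two weights are determined. Comparing the weight of \<open>i\<close> with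
  the product above yields \<open>A i i'\<close>, and finally \<open>\<rho> i\<close>.
\<close>

text \<open>For disjoint sets of nodes \<open>S\<close> and \<open>Z\<close>, this is the
  probability that all of \<open>S\<close> is present and all of \<open>Z\<close> absent, the other
  nodes being summed out.\<close>

definition hub_cylinder ::
  "nat \<Rightarrow> (nat \<Rightarrow> real) \<Rightarrow> (nat \<Rightarrow> nat \<Rightarrow> real) \<Rightarrow> nat set \<Rightarrow> nat set \<Rightarrow> real" where
  "hub_cylinder nL \<rho> A S Z = (\<Sum>i=1..nL. \<rho> i * ((\<Prod>j\<in>S. A i j) * (\<Prod>j\<in>Z. 1 - A i j)))"

text \<open>Given the hub, nodes are independent, so each unconstrained node contributes the factor
  \<open>A i j + (1 - A i j) = 1\<close>.\<close>

lemma sum_hub_prob_cylinder: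
  assumes S: "S \<subseteq> {1..n}" and Z: "Z \<subseteq> {1..n}" and disj: "S \<inter> Z = {}"
  shows "(\<Sum>g\<in>hub_groups n \<inter> {g. (\<forall>j\<in>S. g j = 1) \<and> (\<forall>j\<in>Z. g j = 0)}.
           hub_prob nL n (\<rho>, A) g) = hub_cylinder nL \<rho> A S Z"
proof -
  \<comment> \<open>The values allowed at node \<open>j\<close>: the event becomes a product set,
    over which a sum of products is a product of sums.\<close>
  define B :: "nat \<Rightarrow> nat set"
    where "B j = (if j \<in> S then {1} else if j \<in> Z then {0} else {0, 1})" for j
  have B: "hub_groups n \<inter> {g. (\<forall>j\<in>S. g j = 1) \<and> (\<forall>j\<in>Z. g j = 0)} = PiE {1..n} B"
    using S Z disj unfolding hub_groups_def B_def PiE_iff set_eq_iff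
    by (auto simp: PiE_iff split: if_splits)
  have "(\<Prod>j=1..n. \<Sum>x\<in>B j. A i j ^ x * (1 - A i j) ^ (1 - x))
      = (\<Prod>j\<in>S. A i j) * (\<Prod>j\<in>Z. 1 - A i j)" for i
  proof -
    have "(\<Prod>j=1..n. \<Sum>x\<in>B j. A i j ^ x * (1 - A i j) ^ (1 - x))
        = (\<Prod>j=1..n. (if j \<in> S then A i j else 1) * (if j \<in> Z then 1 - A i j else 1))"
      using disj by (intro prod.cong) (auto simp: B_def)
    also have "\<dots> = (\<Prod>j\<in>{1..n} \<inter> S. A i j) * (\<Prod>j\<in>{1..n} \<inter> Z. 1 - A i j)"
      by (simp add: prod.distrib prod.inter_restrict)
    finally show ?thesis
      using S Z by (simp add: Int_absorb1)
  qed
  moreover have "finite (B j)" for j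
    by (simp add: B_def)
  ultimately have "(\<Sum>g\<in>PiE {1..n} B. \<Prod>j=1..n. A i j ^ g j * (1 - A i j) ^ (1 - g j))
      = (\<Prod>j\<in>S. A i j) * (\<Prod>j\<in>Z. 1 - A i j)" for i
    by (subst prod_sum_PiE [symmetric]) auto
  then show ?thesis
    unfolding B hub_prob_def hub_cylinder_def
    by (simp add: sum.swap [of _ "{Suc 0..nL}"] sum_distrib_left [symmetric])
qed

lemma hub_cylinder_eqI:
  assumes "\<forall>g\<in>hub_groups n. hub_prob nL n (\<rho>', A') g = hub_prob nL n (\<rho>, A) g"
    and "S \<subseteq> {1..n}" "Z \<subseteq> {1..n}" "S \<inter> Z = {}"
  shows "hub_cylinder nL \<rho>' A' S Z = hub_cylinder nL \<rho> A S Z"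
  unfolding sum_hub_prob_cylinder [OF assms(2-4), symmetric]
  using assms(1) by (intro sum.cong) (auto simp: hub_groups_def)

text \<open>A hub outside \<open>S\<close> is required to be absent, so its term contains
  \<open>1 - A i i = 0\<close>; a hub in \<open>S\<close> contributes \<open>A i i = 1\<close>,
  which is dropped from the product.\<close>

lemma hub_cylinder_leaders:
  assumes "S \<subseteq> {1..nL}" "T \<inter> {1..nL} = {}" "finite T"
    and diag: "\<And>i. i \<in> {1..nL} \<Longrightarrow> A i i = 1"
  shows "hub_cylinder nL \<rho> A (S \<union> T) ({1..nL} - S) =
    (\<Sum>i\<in>S. \<rho> i * (\<Prod>j\<in>S - {i}. A i j) * (\<Prod>j\<in>{1..nL} - S. 1 - A i j) * (\<Prod>j\<in>T. A i j))"
proof -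
  have "finite S"
    using assms(1) finite_subset by blast
  have "hub_cylinder nL \<rho> A (S \<union> T) ({1..nL} - S)
      = (\<Sum>i\<in>S. \<rho> i * ((\<Prod>j\<in>S \<union> T. A i j) * (\<Prod>j\<in>{1..nL} - S. 1 - A i j)))"
    unfolding hub_cylinder_def
    using assms(1) diag by (intro sum.mono_neutral_right) force+
  also have "\<dots> = (\<Sum>i\<in>S. \<rho> i * (\<Prod>j\<in>S - {i}. A i j) * (\<Prod>j\<in>{1..nL} - S. 1 - A i j)
      * (\<Prod>j\<in>T. A i j))"
  proof (rule sum.cong)
    fix i assume i: "i \<in> S"
    have "(\<Prod>j\<in>S \<union> T. A i j) = (\<Prod>j\<in>S. A i j) * (\<Prod>j\<in>T. A i j)"
      using assms \<open>finite S\<close> by (intro prod.union_disjoint) auto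
    moreover have "(\<Prod>j\<in>S. A i j) = (\<Prod>j\<in>S - {i}. A i j)"
      using i \<open>finite S\<close> assms(1) diag by (subst prod.remove [of S i]) auto
    ultimately show "\<rho> i * ((\<Prod>j\<in>S \<union> T. A i j) * (\<Prod>j\<in>{1..nL} - S. 1 - A i j))
      = \<rho> i * (\<Prod>j\<in>S - {i}. A i j) * (\<Prod>j\<in>{1..nL} - S. 1 - A i j) * (\<Prod>j\<in>T. A i j)"
      by simp
  qed simp
  finally show ?thesis .
qed

text \<open>Subtracting \<open>b\<close> times the first equation from the second eliminates
  \<open>y\<close> and \<open>y'\<close>.\<close>

lemma mixture_weight_unique:
  fixes a b x y x' y' :: real
  assumes "x' + y' = x + y" "x' * a + y' * b = x * a + y * b" "a \<noteq> b"
  shows "x' = x"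
proof -
  have "(x' - x) * (a - b) = 0"
    using assms(1,2) by (simp add: algebra_simps) algebra
  with assms(3) show ?thesis by simp
qed

theorem theorem1:
  fixes nL n :: nat and \<rho> :: "nat \<Rightarrow> real" and A :: "nat \<Rightarrow> nat \<Rightarrow> real"
  assumes "1 \<le> nL" and "nL \<le> n"
    and "(\<rho>, A) \<in> hub_params nL n"
    and "\<forall>i\<in>{1..nL}. 0 < \<rho> i \<and> \<rho> i < 1"
    and "\<forall>i\<in>{1..nL}. \<forall>j\<in>{1..n}. i \<noteq> j \<longrightarrow> A i j < 1"
    and "\<forall>i\<in>{1..nL}. \<forall>i'\<in>{1..nL}. i \<noteq> i' \<longrightarrow> (\<exists>k\<in>{nL+1..n}. A i k \<noteq> A i' k)"
  shows "hub_identifiable nL n (\<rho>, A)"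
  unfolding hub_identifiable_def
proof (intro ballI impI)
  fix \<theta>' assume "\<theta>' \<in> hub_params nL n"
    and "\<forall>g\<in>hub_groups n. hub_prob nL n \<theta>' g = hub_prob nL n (\<rho>, A) g"
  then obtain \<rho>' A' where \<theta>': "\<theta>' = (\<rho>', A')" and par': "(\<rho>', A') \<in> hub_params nL n"
    and prob: "\<forall>g\<in>hub_groups n. hub_prob nL n (\<rho>', A') g = hub_prob nL n (\<rho>, A) g"
    by (cases \<theta>') auto
  let ?L = "{1..nL}"
  have diag: "A i i = 1" and diag': "A' i i = 1" if "i \<in> ?L" for i
    using that assms(3) par' by (auto simp: hub_params_def)
  have leaders: "(\<Sum>i\<in>S. \<rho>' i * (\<Prod>j\<in>S - {i}. A' i j) * (\<Prod>j\<in>?L - S. 1 - A' i j) * (\<Prod>j\<in>T. A' i j))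
      = (\<Sum>i\<in>S. \<rho> i * (\<Prod>j\<in>S - {i}. A i j) * (\<Prod>j\<in>?L - S. 1 - A i j) * (\<Prod>j\<in>T. A i j))"
    if S: "S \<subseteq> ?L" and T: "T \<subseteq> {nL+1..n}" for S T
  proof -
    have T': "T \<inter> ?L = {}" "finite T"
      using T finite_subset by fastforce+
    have "hub_cylinder nL \<rho>' A' (S \<union> T) (?L - S) = hub_cylinder nL \<rho> A (S \<union> T) (?L - S)"
      using S T T' assms(2) by (intro hub_cylinder_eqI [OF prob]) force+
    then show ?thesis
      by (simp only: hub_cylinder_leaders [where A = A, OF S T' diag]
        hub_cylinder_leaders [where A = A', OF S T' diag'])
  qed
  have single: "\<rho>' i * (\<Prod>j\<in>?L - {i}. 1 - A' i j) = \<rho> i * (\<Prod>j\<in>?L - {i}. 1 - A i j)"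
    if "i \<in> ?L" for i
    using leaders [of "{i}" "{}"] that by simp
  \<comment> \<open>Only the weights of the given parameters are known to be positive; through
    \<open>single\<close> this also governs the primed ones.\<close>
  have pos: "0 < \<rho> i * (\<Prod>j\<in>?L - {i}. 1 - A i j)" if "i \<in> ?L" for i
    using that assms(2,4,5) by (intro mult_pos_pos prod_pos) auto
  \<comment> \<open>Given that \<open>i\<close> is the only leader present, \<open>k\<close> is
    present with probability \<open>A i k\<close>: replace the primed weight using
    \<open>single\<close>, then cancel it.\<close>
  have follower: "A' i k = A i k" if "i \<in> ?L" "k \<in> {nL+1..n}" for i k
  proof -
    have "\<rho>' i * (\<Prod>j\<in>?L - {i}. 1 - A' i j) * A' i k = \<rho> i * (\<Prod>j\<in>?L - {i}. 1 - A i j) * A i k"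
      using leaders [of "{i}" "{k}"] that by simp
    with single [OF that(1)] pos [OF that(1)] show ?thesis
      by (metis less_irrefl mult_left_cancel)
  qed
  have leader: "A' i i' = A i i'" if i: "i \<in> ?L" and i': "i' \<in> ?L" and ne: "i \<noteq> i'" for i i'
  proof -
    \<comment> \<open>The factors for \<open>i\<close> and \<open>i'\<close> are left out, so that
      \<open>d i\<close> splits into \<open>d i * A i i'\<close> (\<open>i'\<close> present) and
      \<open>d i * (1 - A i i')\<close> (\<open>i'\<close> absent).\<close>
    define d d' where "d p = \<rho> p * (\<Prod>j\<in>?L - {i, i'}. 1 - A p j)"
      and "d' p = \<rho>' p * (\<Prod>j\<in>?L - {i, i'}. 1 - A' p j)" for p
    obtain k where k: "k \<in> {nL+1..n}" "A i k \<noteq> A i' k"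
      using assms(6) i i' ne by blast
    have pair: "{i, i'} - {i} = {i'}" "{i, i'} - {i'} = {i}"
      using ne by auto
    have "d' i * A' i i' + d' i' * A' i' i = d i * A i i' + d i' * A i' i"
      using leaders [of "{i, i'}" "{}"] i i' ne by (simp add: pair d_def d'_def mult_ac)
    \<comment> \<open>By \<open>follower\<close>, the primed mixture has the same component
      probabilities \<open>A i k\<close> and \<open>A i' k\<close>, so separation by
      \<open>k\<close> is required for \<open>A\<close> alone.\<close>
    moreover have "d' i * A' i i' * A i k + d' i' * A' i' i * A i' k
        = d i * A i i' * A i k + d i' * A i' i * A i' k"
      using leaders [of "{i, i'}" "{k}"] i i' ne k(1) follower
      by (simp add: pair d_def d'_def mult_ac)
    ultimately have joint: "d' i * A' i i' = d i * A i i'"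
      using k(2) by (rule mixture_weight_unique)
    have split: "(\<Prod>j\<in>?L - {i}. f j) = f i' * (\<Prod>j\<in>?L - {i, i'}. f j)" for f :: "nat \<Rightarrow> real"
    proof -
      have "?L - {i} - {i'} = ?L - {i, i'}" by auto
      then show ?thesis
        using i' ne prod.remove [of "?L - {i}" i' f] by simp
    qed
    have "d' i * (1 - A' i i') = d i * (1 - A i i')"
      using single [OF i, unfolded split] by (simp add: d_def d'_def mult_ac)
    \<comment> \<open>Adding the cases \<open>i'\<close> present and \<open>i'\<close> absent
      eliminates the unknown entry \<open>A' i i'\<close>.\<close>
    with joint have "d' i = d i"
      by (simp add: algebra_simps)
    have "0 < (1 - A i i') * d i"
      using pos [OF i, unfolded split] by (simp only: d_def mult_ac)
    then have "d i \<noteq> 0"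
      by auto
    with joint \<open>d' i = d i\<close> show ?thesis
      by simp
  qed
  have all: "A' i j = A i j" if "i \<in> ?L" "j \<in> {1..n}" for i j
    using that leader follower diag diag' by (cases "j \<le> nL"; cases "i = j") auto
  \<comment> \<open>Once the matrices agree, the two products in \<open>single\<close> coincide and
    cancel.\<close>
  have rho: "\<rho>' i = \<rho> i" if "i \<in> ?L" for i
  proof -
    have "(\<Prod>j\<in>?L - {i}. 1 - A' i j) = (\<Prod>j\<in>?L - {i}. 1 - A i j)"
      using that assms(2) all by (intro prod.cong) auto
    then have "\<rho>' i * (\<Prod>j\<in>?L - {i}. 1 - A i j) = \<rho> i * (\<Prod>j\<in>?L - {i}. 1 - A i j)"
      using single [OF that] by simp
    moreover have "(\<Prod>j\<in>?L - {i}. 1 - A i j) \<noteq> 0"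
      using pos [OF that] by (metis less_irrefl mult_zero_right)
    ultimately show ?thesis
      using mult_right_cancel by blast
  qed
  have mem: "\<rho> \<in> ?L \<rightarrow>\<^sub>E {0..1}" "\<rho>' \<in> ?L \<rightarrow>\<^sub>E {0..1}"
    "A \<in> ?L \<rightarrow>\<^sub>E ({1..n} \<rightarrow>\<^sub>E {0..1})" "A' \<in> ?L \<rightarrow>\<^sub>E ({1..n} \<rightarrow>\<^sub>E {0..1})"
    using assms(3) par' unfolding hub_params_def by blast+
  have "\<rho>' = \<rho>"
    using mem(2,1) rho by (rule PiE_ext)
  moreover have "A' = A"
    using mem(4,3)
  proof (rule PiE_ext)
    fix i assume i: "i \<in> ?L"
    show "A' i = A i"
      using PiE_mem [OF mem(4) i] PiE_mem [OF mem(3) i] all [OF i] by (rule PiE_ext)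
  qed
  ultimately show "\<theta>' = (\<rho>, A)"
    by (simp add: \<theta>')
qed

end
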